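(* Let $n$ be a positive integer. The Dirichlet problem $$\begin{cases}\bar\partial^n w=0, & \text{in }\mathbb{D},\\ w=0, & \text{on }\partial\mathbb{D},\end{cases}$$ for bicomplex-valued functions $w$, has infinitely many solutions.
   Context: $\mathbb{D}$ is the complex unit disk. The bicomplex numbers $\mathbb{B}$ are the commutative algebra of elements $z_1+jz_2$ with $z_1,z_2\in\mathbb{C}$, $j^2=-1$, $ij=ji$. The operator $\bar\partial=\frac12\left(\frac{\partial}{\partial x}+j\frac{\partial}{\partial y}\right)$ acts on $\mathbb{B}$-valued functions of the single complex variable $z=x+iy$, and $\bar\partial^n$ is its $n$-fold composition.
   Formalization: For n = 1 the only solution continuous on the closed disk is w = 0, so infinitely many continuous solutions are claimed only for n ≥ 2; for n = 1 the solutions vanish pointwise on the circle but need not be continuous up to it. *)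

theory Defs
  imports "HOL-Analysis.Analysis"
begin

section \<open>Bicomplex numbers\<close>

text \<open>\<open>Bicomplex a b\<close> stands for \<open>a + j b\<close> with complex \<open>a\<close>, \<open>b\<close>; see \<open>Bicomplex_eq\<close>.\<close>

datatype bicomplex = Bicomplex (bc1: complex) (bc2: complex)

lemma bicomplex_eq_iff: "x = y \<longleftrightarrow> bc1 x = bc1 y \<and> bc2 x = bc2 y"
  by (cases x; cases y) simp

instantiation bicomplex :: comm_ring_1
begin

definition "0 = Bicomplex 0 0"
definition "1 = Bicomplex 1 0"
definition "x + y = Bicomplex (bc1 x + bc1 y) (bc2 x + bc2 y)"
definition "x - y = Bicomplex (bc1 x - bc1 y) (bc2 x - bc2 y)"
definition "- x = Bicomplex (- bc1 x) (- bc2 x)"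
definition "x * y = Bicomplex (bc1 x * bc1 y - bc2 x * bc2 y) (bc1 x * bc2 y + bc2 x * bc1 y)"

instance
  by standard
    (auto simp: zero_bicomplex_def one_bicomplex_def plus_bicomplex_def minus_bicomplex_def
      uminus_bicomplex_def times_bicomplex_def algebra_simps)

end

lemmas bicomplex_defs =
  zero_bicomplex_def one_bicomplex_def plus_bicomplex_def minus_bicomplex_def
  uminus_bicomplex_def times_bicomplex_def

instantiation bicomplex :: real_algebra_1
begin

definition "scaleR r x = Bicomplex (scaleR r (bc1 x)) (scaleR r (bc2 x))"

instance
  by standard (auto simp: bicomplex_defs scaleR_bicomplex_def algebra_simps)

end

text \<open>The topology is that of \<open>\<complex>\<^sup>2\<close>, given by the Euclidean norm.\<close>

instantiation bicomplex :: real_normed_vector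
begin

definition "norm x = norm (bc1 x, bc2 x)"
definition "dist (x :: bicomplex) y = norm (x - y)"
definition "sgn (x :: bicomplex) = scaleR (inverse (norm x)) x"
definition "(uniformity :: (bicomplex \<times> bicomplex) filter) =
  (INF e\<in>{0<..}. principal {(x, y). dist x y < e})"
definition "open (U :: bicomplex set) \<longleftrightarrow>
  (\<forall>x\<in>U. eventually (\<lambda>(x', y). x' = x \<longrightarrow> y \<in> U) uniformity)"

instance
proof
  fix x y :: bicomplex and r :: real
  show "(norm x = 0) = (x = 0)"
    unfolding norm_bicomplex_def norm_eq_zero by (cases x) (simp add: zero_bicomplex_def zero_prod_def)
  show "norm (x + y) \<le> norm x + norm y"
    using norm_triangle_ineq[of "(bc1 x, bc2 x)" "(bc1 y, bc2 y)"]
    by (simp add: norm_bicomplex_def plus_bicomplex_def)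
  show "norm (r *\<^sub>R x) = \<bar>r\<bar> * norm x"
    using norm_scaleR[of r "(bc1 x, bc2 x)"]
    by (simp add: norm_bicomplex_def scaleR_bicomplex_def)
qed (rule dist_bicomplex_def sgn_bicomplex_def uniformity_bicomplex_def open_bicomplex_def)+

end

definition bc_j :: bicomplex where
  "bc_j = Bicomplex 0 1"

lemma bc_j_squared: "bc_j * bc_j = - 1"
  by (simp add: bc_j_def bicomplex_defs)

lemma Bicomplex_eq: "Bicomplex a b = Bicomplex a 0 + bc_j * Bicomplex b 0"
  by (simp add: bc_j_def bicomplex_defs)


section \<open>The bicomplex Cauchy-Riemann operator\<close>

text \<open>Partial derivatives with respect to \<open>x\<close> and \<open>y\<close>, where \<open>z = x + \<i> y\<close>.\<close>

definition pd_x :: "(complex \<Rightarrow> 'b::real_normed_vector) \<Rightarrow> complex \<Rightarrow> 'b" where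
  "pd_x w z = vector_derivative (\<lambda>t. w (z + of_real t)) (at 0)"

definition pd_y :: "(complex \<Rightarrow> 'b::real_normed_vector) \<Rightarrow> complex \<Rightarrow> 'b" where
  "pd_y w z = vector_derivative (\<lambda>t. w (z + \<i> * of_real t)) (at 0)"

definition dbar :: "(complex \<Rightarrow> bicomplex) \<Rightarrow> complex \<Rightarrow> bicomplex" where
  "dbar w z = (1/2) *\<^sub>R (pd_x w z + bc_j * pd_y w z)"

text \<open>\<open>n\<close> times continuously differentiable, in the real sense, on an open set \<open>S\<close>.\<close>

fun C_n_on :: "nat \<Rightarrow> complex set \<Rightarrow> (complex \<Rightarrow> 'b::real_normed_vector) \<Rightarrow> bool" where
  "C_n_on 0 S w \<longleftrightarrow> continuous_on S w"
| "C_n_on (Suc n) S w \<longleftrightarrow>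
     (\<forall>z\<in>S. w differentiable (at z)) \<and> C_n_on n S (pd_x w) \<and> C_n_on n S (pd_y w)"


section \<open>The Dirichlet problem\<close>

text \<open>
  A solution is a function on the closed unit disk. Membership in \<^term>\<open>extensional (cball 0 1)\<close>
  fixes the values outside the disk, so that functions with the same restriction to the disk are
  counted once. The definition contains exactly the two displayed conditions of the problem and
  the regularity that makes the equation meaningful; it does not require \<open>w\<close> to attain its
  boundary values continuously. With this requirement the zero function is the only solution
  for \<open>n = 1\<close>, as the idempotent components of \<open>w\<close> are then an antiholomorphic and a holomorphic
  function which are continuous up to the boundary and vanish there.
\<close>

definition dirichlet_solution :: "nat \<Rightarrow> (complex \<Rightarrow> bicomplex) \<Rightarrow> bool" where
  "dirichlet_solution n w \<longleftrightarrow>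
     w \<in> extensional (cball 0 1) \<and>
     C_n_on n (ball 0 1) w \<and>
     (\<forall>z\<in>ball 0 1. (dbar ^^ n) w z = 0) \<and>
     (\<forall>z\<in>sphere 0 1. w z = 0)"

end

theory Submission
  imports Defs
begin

text \<open>
  Both families consist of multiples of a polynomial \<open>q\<close> with \<open>\<bar>\<partial>\<^sup>n q = 0\<close>. Without continuity
  up to the boundary, take \<open>q = 1\<close> in the open disk and overwrite it by \<open>0\<close> on the circle.
  For \<open>n \<ge> 2\<close> take \<open>q = 1 - x\<^sup>2 - y\<^sup>2\<close>, which vanishes on the circle: here
  \<open>\<bar>\<partial>q = - (x + j y)\<close> and \<open>\<bar>\<partial>\<^sup>2q = - (1 + j\<^sup>2) / 2 = 0\<close>.
\<close>

text \<open>Used with \<open>g\<close> a horizontal or vertical line through a point of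
  \<open>S\<close>: a partial derivative sees only the germ of the function along that line.\<close>

lemma eventually_comp_continuous_at:
  fixes g :: "real \<Rightarrow> 'a::topological_space"
  assumes "open S" "isCont g 0" "g 0 \<in> S" "\<And>z. z \<in> S \<Longrightarrow> P z"
  shows "\<forall>\<^sub>F t in nhds 0. P (g t)"
proof -
  have "(g \<longlongrightarrow> g 0) (nhds 0)"
    using assms(2) by (simp add: continuous_at tendsto_at_iff_tendsto_nhds)
  then have "\<forall>\<^sub>F t in nhds 0. g t \<in> S"
    using assms(1,3) by (rule topological_tendstoD)
  then show ?thesis
    by (rule eventually_mono) (rule assms(4))
qed

lemma pd_x_cong_open:
  assumes "open S" "z \<in> S" "\<And>z. z \<in> S \<Longrightarrow> u z = v z"
  shows "pd_x u z = pd_x v z"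
  unfolding pd_x_def
proof (rule vector_derivative_cong_eq)
  show "\<forall>\<^sub>F t in nhds 0. t \<in> UNIV \<longrightarrow> u (z + of_real t) = v (z + of_real t)"
    using eventually_comp_continuous_at[of S "\<lambda>t. z + of_real t" "\<lambda>z. u z = v z"] assms
    by (simp add: continuous_intros)
qed simp_all

lemma pd_y_cong_open:
  assumes "open S" "z \<in> S" "\<And>z. z \<in> S \<Longrightarrow> u z = v z"
  shows "pd_y u z = pd_y v z"
  unfolding pd_y_def
proof (rule vector_derivative_cong_eq)
  show "\<forall>\<^sub>F t in nhds 0. t \<in> UNIV \<longrightarrow> u (z + \<i> * of_real t) = v (z + \<i> * of_real t)"
    using eventually_comp_continuous_at[of S "\<lambda>t. z + \<i> * of_real t" "\<lambda>z. u z = v z"] assms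
    by (simp add: continuous_intros)
qed simp_all

text \<open>Derivatives at points of an open set depend only on nearby values, so regularity inside
  the disk ignores how a function is redefined on the circle.\<close>

lemma C_n_on_cong_open:
  assumes "open S" "\<And>z. z \<in> S \<Longrightarrow> u z = v z" "C_n_on n S u"
  shows "C_n_on n S v"
  using assms(2,3)
\<comment> \<open>The step applies the hypothesis to the partial derivatives of \<open>u\<close> and
  \<open>v\<close>, hence the generalization.\<close>
proof (induction n arbitrary: u v)
  case 0
  then show ?case
    using continuous_on_cong[of S S u v] by simp
next
  case (Suc n)
  have "v differentiable (at z)" if "z \<in> S" for z
  proof -
    obtain D where "(u has_derivative D) (at z)"
      using Suc.prems(2) \<open>z \<in> S\<close> by (auto simp: differentiable_def)
    then have "(v has_derivative D) (at z)"
      using assms(1) \<open>z \<in> S\<close> Suc.prems(1) by (rule has_derivative_transform_within_open)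
    then show ?thesis
      by (auto simp: differentiable_def)
  qed
  moreover have "C_n_on n S (pd_x v)"
  proof (rule Suc.IH)
    show "pd_x u z = pd_x v z" if "z \<in> S" for z
      using pd_x_cong_open[OF assms(1) that Suc.prems(1)] .
    show "C_n_on n S (pd_x u)"
      using Suc.prems(2) by simp
  qed
  moreover have "C_n_on n S (pd_y v)"
  proof (rule Suc.IH)
    show "pd_y u z = pd_y v z" if "z \<in> S" for z
      using pd_y_cong_open[OF assms(1) that Suc.prems(1)] .
    show "C_n_on n S (pd_y u)"
      using Suc.prems(2) by simp
  qed
  ultimately show ?case by simp
qed

lemma dbar_funpow_cong_open:
  assumes "open S" "z \<in> S" "\<And>z. z \<in> S \<Longrightarrow> u z = v z"
  shows "(dbar ^^ n) u z = (dbar ^^ n) v z"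
  using assms(2)
\<comment> \<open>Differentiating once more takes equality of the previous iterates on all of
  \<open>S\<close>, not only at the given point.\<close>
proof (induction n arbitrary: z)
  case 0
  then show ?case using assms(3) by simp
next
  case (Suc n)
  show ?case
    using pd_x_cong_open[OF assms(1) Suc.prems Suc.IH] pd_y_cong_open[OF assms(1) Suc.prems Suc.IH]
    by (simp add: dbar_def)
qed

text \<open>These polynomials are closed under both partial derivatives, so smoothness follows by
  induction.\<close>

definition radial_quadratic ::
    "'b::real_normed_vector \<Rightarrow> 'b \<Rightarrow> 'b \<Rightarrow> 'b \<Rightarrow> complex \<Rightarrow> 'b" where
  "radial_quadratic a b c d z =
     a + Re z *\<^sub>R b + Im z *\<^sub>R c + ((Re z)\<^sup>2 + (Im z)\<^sup>2) *\<^sub>R d"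

lemma pd_x_radial_quadratic:
  "pd_x (radial_quadratic a b c d) = radial_quadratic b (2 *\<^sub>R d) 0 0"
proof
  fix z
  have "((\<lambda>t. radial_quadratic a b c d (z + of_real t)) has_vector_derivative
      radial_quadratic b (2 *\<^sub>R d) 0 0 z) (at 0)"
    unfolding radial_quadratic_def
    by (auto intro!: derivative_eq_intros simp: algebra_simps)
  then show "pd_x (radial_quadratic a b c d) z = radial_quadratic b (2 *\<^sub>R d) 0 0 z"
    unfolding pd_x_def by (rule vector_derivative_at)
qed

lemma pd_y_radial_quadratic:
  "pd_y (radial_quadratic a b c d) = radial_quadratic c 0 (2 *\<^sub>R d) 0"
proof
  fix z
  have "((\<lambda>t. radial_quadratic a b c d (z + \<i> * of_real t)) has_vector_derivative
      radial_quadratic c 0 (2 *\<^sub>R d) 0 z) (at 0)"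
    unfolding radial_quadratic_def
    by (auto intro!: derivative_eq_intros simp: algebra_simps)
  then show "pd_y (radial_quadratic a b c d) z = radial_quadratic c 0 (2 *\<^sub>R d) 0 z"
    unfolding pd_y_def by (rule vector_derivative_at)
qed

lemma continuous_on_radial_quadratic: "continuous_on S (radial_quadratic a b c d)"
  unfolding radial_quadratic_def by (intro continuous_intros)

lemma differentiable_radial_quadratic: "radial_quadratic a b c d differentiable (at z)"
  unfolding radial_quadratic_def differentiable_def
  \<comment> \<open>The derivative stays schematic and is assembled by the differentiation
    rules.\<close>
  by (rule exI) (rule derivative_eq_intros refl)+

lemma C_n_on_radial_quadratic: "C_n_on n S (radial_quadratic a b c d)"
  by (induction n arbitrary: a b c d)
    (auto simp: continuous_on_radial_quadratic differentiable_radial_quadratic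
      pd_x_radial_quadratic pd_y_radial_quadratic)

text \<open>\<open>dbar\<close> sends x^2 + y^2 to x + j y, so the quadratic term leaves the linear
  part (x + j y) d, which a further \<open>dbar\<close> annihilates since 1 + j^2 = 0.\<close>

lemma dbar_radial_quadratic:
  "dbar (radial_quadratic a b c d) =
     radial_quadratic ((1/2) *\<^sub>R (b + bc_j * c)) d (bc_j * d) 0"
  by (rule ext)
    (simp add: dbar_def pd_x_radial_quadratic pd_y_radial_quadratic radial_quadratic_def
      algebra_simps)

lemma dbar_funpow_radial_quadratic_0:
  "(dbar ^^ n) (radial_quadratic 0 0 0 0) = radial_quadratic 0 0 0 0"
  by (induction n) (simp_all add: dbar_radial_quadratic)

lemma dbar_funpow_const:
  assumes "n \<ge> 1"
  shows "(dbar ^^ n) (radial_quadratic a 0 0 0) z = 0"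
proof -
  obtain m where "n = Suc m"
    using assms by (cases n) auto
  then show ?thesis
    \<comment> \<open>The innermost \<open>dbar\<close> is peeled off and kills the constant; the
      other \<open>m\<close> act on the zero polynomial.\<close>
    by (simp add: funpow_Suc_right dbar_radial_quadratic dbar_funpow_radial_quadratic_0
        radial_quadratic_def del: funpow.simps)
qed

lemma dbar_funpow_radial_quadratic:
  assumes "n \<ge> 2"
  shows "(dbar ^^ n) (radial_quadratic a 0 0 d) z = 0"
proof -
  obtain m where "n = Suc (Suc m)"
    using assms by (metis Suc_le_D numeral_2_eq_2 Suc_le_mono)
  \<comment> \<open>After two applications only the constant (d + j (j d)) / 2 remains, and this
    identity makes it zero.\<close>
  moreover have "bc_j * (bc_j * d) = - d"
    by (simp add: mult.assoc[symmetric] bc_j_squared)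
  ultimately show ?thesis
    by (simp add: funpow_Suc_right dbar_radial_quadratic dbar_funpow_radial_quadratic_0
        radial_quadratic_def del: funpow.simps)
qed

text \<open>The conditional imposes the boundary value; \<open>restrict\<close> gives the value
  \<open>undefined\<close> outside the closed disk, as \<open>extensional\<close> demands.\<close>

definition extend_by_zero :: "(complex \<Rightarrow> 'b::zero) \<Rightarrow> complex \<Rightarrow> 'b" where
  "extend_by_zero q = restrict (\<lambda>z. if z \<in> ball 0 1 then q z else 0) (cball 0 1)"

text \<open>Overwriting the circle leaves the germs at points of the open disk unchanged, so
  regularity and the equation carry over.\<close>

lemma dirichlet_solution_extend_by_zero:
  assumes "C_n_on n (ball 0 1) q" "\<And>z. z \<in> ball 0 1 \<Longrightarrow> (dbar ^^ n) q z = 0"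
  shows "dirichlet_solution n (extend_by_zero q)"
proof -
  have eq: "q z = extend_by_zero q z" if "z \<in> ball 0 1" for z
    using that by (simp add: extend_by_zero_def)
  have "C_n_on n (ball 0 1) (extend_by_zero q)"
    by (rule C_n_on_cong_open[OF open_ball eq assms(1)])
  moreover have "(dbar ^^ n) (extend_by_zero q) z = 0" if "z \<in> ball 0 1" for z
    using dbar_funpow_cong_open[OF open_ball that eq] assms(2)[OF that] by simp
  ultimately show ?thesis
    by (auto simp: dirichlet_solution_def extend_by_zero_def)
qed

text \<open>Evaluation at 0 maps the set onto a superset of the embedded reals, which are infinitely
  many because \<open>of_real\<close> is injective.\<close>

lemma infinite_if_all_values_at_0:
  assumes "\<And>c::real. \<exists>w::complex \<Rightarrow> 'b::real_algebra_1. P w \<and> w 0 = of_real c"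
  shows "infinite {w. P w}"
proof
  assume "finite {w. P w}"
  then have "finite ((\<lambda>w. w 0) ` {w. P w})"
    by (rule finite_imageI)
  moreover have "range (of_real :: real \<Rightarrow> 'b) \<subseteq> (\<lambda>w. w 0) ` {w. P w}"
  proof (rule image_subsetI)
    fix c :: real
    obtain w where "P w" "w 0 = (of_real c :: 'b)"
      using assms by blast
    then show "of_real c \<in> (\<lambda>w. w 0) ` {w. P w}"
      by (metis (mono_tags) imageI mem_Collect_eq)
  qed
  ultimately have "finite (range (of_real :: real \<Rightarrow> 'b))"
    by (rule rev_finite_subset)
  then show False
    using infinite_UNIV_char_0 by (auto dest!: finite_imageD simp: inj_on_def)
qed

theorem corollary3p3:
  fixes n :: nat
  assumes "n \<ge> 1"
  shows "infinite {w. dirichlet_solution n w} \<and>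
    (n \<ge> 2 \<longrightarrow> infinite {w. dirichlet_solution n w \<and> continuous_on (cball 0 1) w})"
proof (intro conjI impI)
  show "infinite {w. dirichlet_solution n w}"
  proof (rule infinite_if_all_values_at_0)
    fix c :: real
    let ?w = "extend_by_zero (radial_quadratic (of_real c) 0 0 0)"
    have "dirichlet_solution n ?w"
      by (intro dirichlet_solution_extend_by_zero C_n_on_radial_quadratic
          dbar_funpow_const[OF assms])
    then show "\<exists>w. dirichlet_solution n w \<and> w 0 = of_real c"
      by (intro exI[of _ ?w]) (simp add: extend_by_zero_def radial_quadratic_def)
  qed
next
  assume "n \<ge> 2"
  show "infinite {w. dirichlet_solution n w \<and> continuous_on (cball 0 1) w}"
  proof (rule infinite_if_all_values_at_0)
    fix c :: real
    \<comment> \<open>This is c (1 - |z|^2), which vanishes on the unit circle and equals c at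
      0.\<close>
    let ?q = "radial_quadratic (of_real c) 0 0 (- of_real c) :: complex \<Rightarrow> bicomplex"
    let ?w = "extend_by_zero ?q"
    have "dirichlet_solution n ?w"
      by (intro dirichlet_solution_extend_by_zero C_n_on_radial_quadratic
          dbar_funpow_radial_quadratic[OF \<open>n \<ge> 2\<close>])
    \<comment> \<open>The polynomial is already 0 on the circle, so the overwriting changes nothing
      and \<open>?w\<close> inherits its continuity.\<close>
    moreover have "?w z = ?q z" if "z \<in> cball 0 1" for z
    proof (cases "z \<in> ball 0 1")
      case False
      with that have "(Re z)\<^sup>2 + (Im z)\<^sup>2 = 1"
        using cmod_power2[of z] by simp
      with False that show ?thesis
        by (simp add: extend_by_zero_def radial_quadratic_def)
    qed (simp add: extend_by_zero_def)
    then have "continuous_on (cball 0 1) ?w"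
      using continuous_on_radial_quadratic continuous_on_cong by metis
    moreover have "?w 0 = of_real c"
      by (simp add: extend_by_zero_def radial_quadratic_def)
    ultimately show "\<exists>w. (dirichlet_solution n w \<and> continuous_on (cball 0 1) w) \<and> w 0 = of_real c"
      by blast
  qed
qed

end
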